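(* Let $T>0$, $\Delta f=1/T$, let $M,N$ be positive integers, and let $0\le\tau_0<T$, $0\le\nu_0<\Delta f$. Let $q(t)=1$ for $0\le t<NT$ and $q(t)=0$ otherwise, let $s(t)=\int_0^{M\Delta f}e^{j2\pi ft}\,df$, and let $$\psi^{(q,s)}_{(\tau_0,\nu_0)}(t)=\big(p_{(\tau_0,\nu_0)}(t)\,q(t)\big)\star s(t)=\sqrt{T}\sum_{n=0}^{N-1}e^{j2\pi\nu_0nT}\,s(t-\tau_0-nT),$$ where $p_{(\tau_0,\nu_0)}(t)=\sqrt{T}\sum_{n=-\infty}^{\infty}e^{j2\pi\nu_0nT}\delta(t-\tau_0-nT)$. Then the ZAK representation of $\psi^{(q,s)}_{(\tau_0,\nu_0)}(t)$ is given by $$\mathcal{Z}_{\psi,\tau_0,\nu_0}(\tau,\nu)=\mathcal{Z}_q(\tau_0,\nu-\nu_0)\,\mathcal{Z}_s(\tau-\tau_0,\nu),$$ where $\mathcal{Z}_q(\tau,\nu)$ and $\mathcal{Z}_s(\tau,\nu)$ are the ZAK representations of $q(t)$ and $s(t)$. These representations are given by $$\mathcal{Z}_q(\tau,\nu)=\sqrt{T}\,e^{j2\pi\nu\lfloor\tau/T\rfloor T}\,e^{-j\pi\nu(N-1)T}\,\frac{\sin(\pi\nu NT)}{\sin(\pi\nu T)},$$ $$\mathcal{Z}_s(\tau,\nu)=\frac{1}{\sqrt{T}}\,e^{j2\pi\nu\tau}\,e^{-j2\pi\lfloor\nu/\Delta f\rfloor\Delta f\,\tau}\,e^{j\pi(M-1)\Delta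 f\,\tau}\,\frac{\sin(\pi M\Delta f\,\tau)}{\sin(\pi\Delta f\,\tau)}.$$
   Context: Here $j=\sqrt{-1}$, $\delta$ is the Dirac delta impulse, $\star$ is time-domain convolution, and $\lfloor\cdot\rfloor$ is the floor function. For a complex continuous-time (time-domain) signal $x(t)$, the ZAK representation (with parameter $T$) is $$\mathcal{Z}_x(\tau,\nu)=\sqrt{T}\sum_{n=-\infty}^{\infty}x(\tau+nT)\,e^{-j2\pi n\nu T},\qquad -\infty<\tau<\infty,\ -\infty<\nu<\infty.$$ At zeros of the denominators the ratios of sines take their limiting values.
   Formalization: The closed form of Z_s is stated only when ν/Δf is not an integer or Mτ/T is an integer; elsewhere the printed formula fails, since the series, summed symmetrically, gives the mean of the one-sided limits in ν (e.g. T=M=1, τ=1/2, ν=0 gives 0, not 1). *)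

theory Defs
  imports "HOL-Analysis.Analysis"
begin

text \<open>
  The sum over all integers is read as the limit of the symmetric partial sums, the usual
  convention for Fourier series.  A weaker notion than absolute summability is needed, since the
  terms of the ZAK series of the pulse \<open>s\<close> decay only like \<open>1 / n\<close>; when \<open>\<nu> * T\<close> is an integer
  and \<open>M * \<tau> / T\<close> is not, even the two one-sided series diverge.  At exactly these points
  \<open>\<nu> \<mapsto> zak T s \<tau> \<nu>\<close> has a jump and the series takes the mean of its one-sided limits, whereas the
  closed form with the floor function takes the limit from the right.
\<close>

definition bilateral_partial_sum :: "(int \<Rightarrow> complex) \<Rightarrow> nat \<Rightarrow> complex" where
  "bilateral_partial_sum f K = (\<Sum>n = - int K..int K. f n)"

definition bilateral_convergent :: "(int \<Rightarrow> complex) \<Rightarrow> bool" where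
  "bilateral_convergent f \<longleftrightarrow> convergent (bilateral_partial_sum f)"

definition bilateral_sum :: "(int \<Rightarrow> complex) \<Rightarrow> complex" where
  "bilateral_sum f = lim (bilateral_partial_sum f)"

definition zak_term :: "real \<Rightarrow> (real \<Rightarrow> complex) \<Rightarrow> real \<Rightarrow> real \<Rightarrow> int \<Rightarrow> complex" where
  "zak_term T x \<tau> \<nu> n = x (\<tau> + of_int n * T) * cis (- 2 * pi * of_int n * \<nu> * T)"

definition zak :: "real \<Rightarrow> (real \<Rightarrow> complex) \<Rightarrow> real \<Rightarrow> real \<Rightarrow> complex" where
  "zak T x \<tau> \<nu> = of_real (sqrt T) * bilateral_sum (zak_term T x \<tau> \<nu>)"

text \<open>
  Combinations of Dirac impulses are represented as functionals \<open>\<phi> \<mapsto> \<integral> \<phi>(t) \<Lambda>(t) dt\<close>.  They act on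
  arbitrary functions, not only on continuous ones, so that a train of impulses may be multiplied
  by a window that jumps at the location of an impulse: \<open>q(t) \<delta>(t - a) = q(a) \<delta>(t - a)\<close>.
\<close>

type_synonym impulses = "(real \<Rightarrow> complex) \<Rightarrow> complex"

definition dirac_at :: "real \<Rightarrow> impulses" where
  "dirac_at a = (\<lambda>\<phi>. \<phi> a)"

definition impulse_mult :: "impulses \<Rightarrow> (real \<Rightarrow> complex) \<Rightarrow> impulses" where
  "impulse_mult \<Lambda> q = (\<lambda>\<phi>. \<Lambda> (\<lambda>u. q u * \<phi> u))"

definition impulse_convolve :: "impulses \<Rightarrow> (real \<Rightarrow> complex) \<Rightarrow> real \<Rightarrow> complex" where
  "impulse_convolve \<Lambda> s t = \<Lambda> (\<lambda>u. s (t - u))"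

definition pulsone :: "real \<Rightarrow> real \<Rightarrow> real \<Rightarrow> impulses" where
  "pulsone T \<tau>\<^sub>0 \<nu>\<^sub>0 = (\<lambda>\<phi>. of_real (sqrt T) *
     bilateral_sum (\<lambda>n. cis (2 * pi * \<nu>\<^sub>0 * of_int n * T) * dirac_at (\<tau>\<^sub>0 + of_int n * T) \<phi>))"

text \<open>The quotient \<open>sin (L x) / sin x\<close>, with its limiting value at zeros of the denominator.\<close>

definition sine_ratio :: "nat \<Rightarrow> real \<Rightarrow> real" where
  "sine_ratio L x =
     (if sin x = 0 then Lim (at x) (\<lambda>y. sin (real L * y) / sin y)
      else sin (real L * x) / sin x)"

end

theory Submission
  imports Defs
begin

text \<open>
  With \<open>x = \<tau> / T\<close> and \<open>y = \<nu> * T\<close>, splitting the band \<open>[0, M / T]\<close> into \<open>M\<close> unit bands gives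
  \<open>s (\<tau> + n * T) = (1 / T) * (\<Sum>m<M. turn (m * x)) * unit_band (x + n)\<close>.  The finite sum is the ratio
  of sines, and \<open>unit_band (x + n)\<close> is a Fourier coefficient of \<open>u \<mapsto> turn (x * u)\<close> on \<open>[0, 1]\<close>, so
  the ZAK series of \<open>s\<close> is the Fourier series of this function at the fractional part of \<open>y\<close>.
  At an integer \<open>y\<close> this is an end point of the interval; the series still converges, and its value
  matters only if \<open>x\<close> is an integer or the finite sum vanishes.  The ZAK series of \<open>q\<close> is a finite
  geometric sum.  The factorization of the ZAK series of \<open>\<psi>\<close> follows by shifting the summation index,
  which symmetric summation permits because the terms tend to \<open>0\<close>.
\<close>

section \<open>Finite exponential sums and the ratio of sines\<close>

lemma sin_mult_cis: "of_real (sin x) * cis x = (cis (2 * x) - 1) / (2 * \<i>)"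
proof -
  have "2 * \<i> * (of_real (sin x) * cis x) = cis (2 * x) - 1"
    by (simp add: complex_eq_iff cos_double_sin sin_double power2_eq_square)
  then show ?thesis
    by (simp add: field_simps)
qed

text \<open>By \<open>sin_mult_cis\<close> the factor in front is \<open>cis (2 * x) - 1\<close> up
  to a constant, so the geometric sum telescopes. Without a division the identity also covers the
  zeros of \<open>sin x\<close>.\<close>

lemma sum_cis_double:
  "of_real (sin x) * cis x * (\<Sum>m<L. cis (2 * real m * x)) = of_real (sin (real L * x)) * cis (real L * x)"
proof (induction L)
  case (Suc L)
  have "cis (2 * (real (Suc L) * x)) = cis (2 * x) * cis (2 * real L * x)"
    by (simp add: cis_mult algebra_simps)
  then have "of_real (sin (real (Suc L) * x)) * cis (real (Suc L) * x)
      = of_real (sin (real L * x)) * cis (real L * x)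
        + of_real (sin x) * cis x * cis (2 * real L * x)"
    unfolding sin_mult_cis by (simp add: diff_divide_distrib right_diff_distrib left_diff_distrib mult.assoc)
  then show ?case
    by (simp only: sum.lessThan_Suc distrib_left Suc)
qed simp

text \<open>The exponential sum is continuous everywhere and agrees with the quotient wherever
  \<open>sin\<close> is nonzero, so it also yields the limiting value in
  \<open>sine_ratio\<close>.\<close>

lemma sum_cis_eq_sine_ratio:
  "(\<Sum>m<L. cis (2 * real m * x)) = cis ((real L - 1) * x) * of_real (sine_ratio L x)"
proof -
  \<comment> \<open>The rotation makes the frequencies \<open>2 * m\<close> symmetric about 0, so
    \<open>g\<close> should be real, like the ratio of sines.\<close>
  define g where "g y = cis (- ((real L - 1) * y)) * (\<Sum>m<L. cis (2 * real m * y))" for y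
  have ratio: "of_real (sin (real L * y) / sin y) = g y" if "sin y \<noteq> 0" for y
  proof -
    have "cis (- ((real L - 1) * y)) = cis (- (real L * y)) * cis y"
      by (simp add: cis_mult algebra_simps)
    then have "of_real (sin y) * g y
        = cis (- (real L * y)) * (of_real (sin y) * cis y * (\<Sum>m<L. cis (2 * real m * y)))"
      unfolding g_def by (simp add: mult_ac)
    also have "\<dots> = of_real (sin (real L * y))"
      unfolding sum_cis_double by (simp add: cis_mult)
    finally show ?thesis
      using that by (simp add: field_simps)
  qed
  have "of_real (sine_ratio L x) = g x"
  proof (cases "sin x = 0")
    case True
    then obtain i :: int where i: "x = of_int i * pi"
      by (auto simp: sin_zero_iff_int2)
    \<comment> \<open>Zeros of \<open>sin\<close> are \<open>pi\<close> apart, so the punctured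
      neighbourhood of radius \<open>pi\<close> contains none.\<close>
    have nz: "sin y \<noteq> 0" if "y \<noteq> x" "dist y x < pi" for y
    proof
      assume "sin y = 0"
      then obtain k :: int where k: "y = of_int k * pi"
        by (auto simp: sin_zero_iff_int2)
      have "\<bar>real_of_int (k - i)\<bar> * pi < 1 * pi"
        using that(2) unfolding i k dist_real_def
        by (simp add: left_diff_distrib[symmetric] abs_mult)
      then have "\<bar>real_of_int (k - i)\<bar> < 1"
        by (simp only: mult_less_cancel_right_pos pi_gt_zero)
      then show False
        using that(1) i k by simp
    qed
    have "g \<midarrow>x\<rightarrow> g x"
      unfolding g_def by (intro tendsto_intros)
    \<comment> \<open>The limit in \<open>sine_ratio\<close> is real: the real part of
      \<open>g\<close> identifies it, and the imaginary part vanishes near \<open>x\<close>, hence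
      at \<open>x\<close>.\<close>
    then have "(\<lambda>y. Re (g y)) \<midarrow>x\<rightarrow> Re (g x)" and Im: "(\<lambda>y. Im (g y)) \<midarrow>x\<rightarrow> Im (g x)"
      by (auto intro: tendsto_intros)
    have ev: "\<forall>\<^sub>F y in at x. sin y \<noteq> 0"
      unfolding eventually_at using nz pi_gt_zero by blast
    have "((\<lambda>y. sin (real L * y) / sin y) \<longlongrightarrow> Re (g x)) (at x)"
      by (rule Lim_transform_eventually[OF \<open>(\<lambda>y. Re (g y)) \<midarrow>x\<rightarrow> Re (g x)\<close>])
        (use ev in eventually_elim, simp flip: ratio)
    then have "sine_ratio L x = Re (g x)"
      using True unfolding sine_ratio_def by (auto intro: tendsto_Lim)
    moreover have "((\<lambda>y. 0) \<longlongrightarrow> Im (g x)) (at x)"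
      by (rule Lim_transform_eventually[OF Im])
        (use ev in eventually_elim, simp flip: ratio)
    then have "Im (g x) = 0"
      by (rule LIM_const_eq[symmetric])
    ultimately show ?thesis
      by (simp add: complex_eq_iff)
  next
    case False
    then show ?thesis
      using ratio[of x] by (simp add: sine_ratio_def)
  qed
  then show ?thesis
    unfolding g_def by (simp add: mult.assoc[symmetric] cis_mult)
qed

section \<open>The exponential of period 1 and the transform of the unit band\<close>

text \<open>Angles are counted in full turns, so integer shifts of the argument drop out.\<close>

definition turn :: "real \<Rightarrow> complex" where
  "turn x = cis (2 * pi * x)"

lemma turn_0 [simp]: "turn 0 = 1"
  by (simp add: turn_def)

lemma turn_add: "turn (x + y) = turn x * turn y"
  by (simp add: turn_def cis_mult distrib_left)

lemma norm_turn [simp]: "norm (turn x) = 1"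
  by (simp add: turn_def)

lemma turn_of_int [simp]: "turn (of_int n) = 1"
  by (simp add: turn_def cis_multiple_2pi)

lemma turn_power: "turn x ^ n = turn (real n * x)"
  by (induction n) (simp_all add: distrib_right turn_add)

lemma turn_eq_1_iff: "turn x = 1 \<longleftrightarrow> x \<in> \<int>"
proof
  assume "turn x = 1"
  then have "cos (2 * pi * x) = 1"
    by (simp add: turn_def complex_eq_iff)
  then obtain n :: int where "2 * pi * x = of_int n * 2 * pi"
    using cos_one_2pi_int by blast
  then have "x = of_int n"
    by simp
  then show "x \<in> \<int>"
    by simp
qed (auto elim: Ints_cases)

lemma continuous_on_turn [continuous_intros]:
  "continuous_on A f \<Longrightarrow> continuous_on A (\<lambda>u. turn (f u))"
  unfolding turn_def by (intro continuous_intros)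

lemma has_vector_derivative_turn:
  "((\<lambda>u. turn (u * z)) has_vector_derivative (2 * pi * z * \<i>) * turn (u * z)) (at u within A)"
  unfolding turn_def has_vector_derivative_complex_iff
  by (auto intro!: derivative_eq_intros)

lemma has_integral_turn:
  assumes "z \<noteq> 0" "a \<le> b"
  shows "((\<lambda>u. turn (u * z)) has_integral (turn (b * z) - turn (a * z)) / (2 * pi * z * \<i>)) {a..b}"
proof -
  have "((\<lambda>u. 2 * pi * z * \<i> * turn (u * z)) has_integral turn (b * z) - turn (a * z)) {a..b}"
    using assms(2) has_vector_derivative_turn by (rule fundamental_theorem_of_calculus)
  from has_integral_mult_right[OF this, of "1 / (2 * pi * z * \<i>)"] show ?thesis
    using assms(1) by (simp add: field_simps)
qed

text \<open>The integral form includes the removable singularity at \<open>0\<close>, where the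
  quotient formula fails.\<close>

definition unit_band :: "real \<Rightarrow> complex" where
  "unit_band z = integral {0..1} (\<lambda>u. turn (u * z))"

lemma unit_band_0 [simp]: "unit_band 0 = 1"
  by (simp add: unit_band_def)

lemma unit_band_eq: "z \<noteq> 0 \<Longrightarrow> unit_band z = (turn z - 1) / (2 * pi * z * \<i>)"
  unfolding unit_band_def using has_integral_turn[of z 0 1] by (simp add: integral_unique)

lemma unit_band_of_int: "unit_band (of_int n) = (if n = 0 then 1 else 0)"
  by (simp add: unit_band_eq)

lemma norm_unit_band_le: "z \<noteq> 0 \<Longrightarrow> norm (unit_band z) \<le> 1 / \<bar>z\<bar>"
proof -
  assume "z \<noteq> 0"
  have "norm (turn z - 1) \<le> 2"
    using norm_triangle_ineq4[of "turn z" 1] by simp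
  moreover have "2 \<le> 2 * pi"
    using pi_ge_two by simp
  ultimately have "norm (turn z - 1) \<le> 2 * pi"
    by linarith
  then have "norm (turn z - 1) / (2 * pi * \<bar>z\<bar>) \<le> 2 * pi / (2 * pi * \<bar>z\<bar>)"
    by (intro divide_right_mono) auto
  then show ?thesis
    using \<open>z \<noteq> 0\<close> by (simp add: unit_band_eq norm_divide norm_mult)
qed

text \<open>Moving the unit band by \<open>m\<close> multiplies its transform by
  \<open>turn (m * (t / T))\<close>. Algebraically this is the factorization of
  \<open>turn z ^ M - 1\<close> by \<open>turn z - 1\<close>; only \<open>t = 0\<close> needs a
  separate case.\<close>

lemma integral_cis_band:
  assumes "T > 0"
  shows "integral {0..real M * (1 / T)} (\<lambda>f. cis (2 * pi * f * t))
      = of_real (1 / T) * (\<Sum>m<M. turn (real m * (t / T))) * unit_band (t / T)"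
proof (cases "t = 0")
  case True
  then show ?thesis
    using assms by (simp add: scaleR_conv_of_real)
next
  case False
  have "(\<lambda>f. cis (2 * pi * f * t)) = (\<lambda>f. turn (f * t))"
    by (simp add: turn_def mult.assoc)
  then have "integral {0..real M * (1 / T)} (\<lambda>f. cis (2 * pi * f * t))
      = (turn (real M * (t / T)) - 1) / (2 * pi * t * \<i>)"
    using has_integral_turn[OF False, of 0 "real M * (1 / T)"] assms
    by (simp add: integral_unique)
  also have "turn (real M * (t / T)) - 1
      = (turn (t / T) - 1) * (\<Sum>m<M. turn (real m * (t / T)))"
    using power_diff_1_eq[of "turn (t / T)" M] by (simp add: turn_power)
  finally show ?thesis
    using False assms by (simp add: unit_band_eq)
qed

lemma continuous_on_unit_band [continuous_intros]:
  assumes "continuous_on A f"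
  shows "continuous_on A (\<lambda>u. unit_band (f u))"
proof -
  have "continuous_on (UNIV \<times> cbox 0 1) (\<lambda>(z, u). turn (u * z))"
    unfolding split_beta by (intro continuous_intros)
  then have "continuous_on UNIV unit_band"
    using integral_continuous_on_param[of UNIV 0 1 "\<lambda>z u. turn (u * z)"]
    by (simp add: unit_band_def[abs_def])
  then show ?thesis
    using assms by (rule continuous_on_compose2) simp
qed

lemma turn_minus_1: "turn z - 1 = 2 * pi * z * \<i> * unit_band z"
  by (cases "z = 0") (simp_all add: unit_band_eq)

text \<open>The only zeros are the nonzero integers. This lets \<open>unit_band (u - y)\<close>
  stand in a denominator.\<close>

lemma unit_band_nonzero: "\<bar>z\<bar> < 1 \<Longrightarrow> unit_band z \<noteq> 0"
proof
  assume "\<bar>z\<bar> < 1" and zero: "unit_band z = 0"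
  from zero have "z \<in> \<int>"
    using turn_minus_1[of z] by (simp add: turn_eq_1_iff[symmetric])
  then have "z = 0"
    using \<open>\<bar>z\<bar> < 1\<close> by (auto elim!: Ints_cases)
  then show False
    using zero by simp
qed

section \<open>The Riemann-Lebesgue lemma for continuous functions on the unit interval\<close>

text \<open>On each of the \<open>\<bar>n\<bar>\<close> periods of the exponential, \<open>h\<close> can be replaced by a constant.\<close>

lemma norm_fourier_coefficient_le:
  fixes h :: "real \<Rightarrow> complex" and n :: int
  assumes cont: "continuous_on {0..1} h" and "n \<noteq> 0"
    and osc: "\<And>u v. u \<in> {0..1} \<Longrightarrow> v \<in> {0..1} \<Longrightarrow> \<bar>u - v\<bar> \<le> 1 / \<bar>n\<bar> \<Longrightarrow> norm (h u - h v) \<le> e"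
  shows "norm (integral {0..1} (\<lambda>u. h u * turn (of_int n * u))) \<le> e"
proof -
  define L where "L = nat \<bar>n\<bar>"
  have L: "L > 0" "real L = \<bar>n\<bar>"
    using \<open>n \<noteq> 0\<close> by (auto simp: L_def)
  define F where "F u = h u * turn (of_int n * u)" for u
  have contF: "continuous_on {0..1} F"
    unfolding F_def by (intro continuous_intros cont)
  have grid: "turn (real k / L * of_int n) = 1" for k
  proof -
    have "real k / L * of_int n = of_int (int k * sgn n)"
      using \<open>n \<noteq> 0\<close> by (auto simp: L(2) sgn_if)
    then show ?thesis
      by (metis turn_of_int)
  qed
  \<comment> \<open>Each of the \<open>L\<close> cells has length \<open>1 / L\<close> and adds at
    most \<open>e / L\<close>.\<close>
  have "norm (integral {0..real k / L} F) \<le> e * (real k / L)" if "k \<le> L" for k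
    using that
  proof (induction k)
    case (Suc k)
    define a where "a = real k / L"
    define b where "b = real (Suc k) / L"
    have ab: "0 \<le> a" "a \<le> b" "b \<le> 1" "b - a = 1 / \<bar>n\<bar>"
      using Suc.prems L by (auto simp: a_def b_def field_simps)
    have sub: "{a..b} \<subseteq> {0..1}" "{0..b} \<subseteq> {0..1}"
      using ab by auto
    \<comment> \<open>A cell is a full period, so the exponential integrates to zero there and
      subtracting \<open>h a\<close> times it leaves the integral unchanged.\<close>
    have "turn (b * of_int n) = turn (a * of_int n)"
      unfolding a_def b_def grid ..
    then have "((\<lambda>u. turn (u * of_int n)) has_integral 0) {a..b}"
      using has_integral_turn[of "of_int n" a b] ab(2) \<open>n \<noteq> 0\<close> by simp
    then have "((\<lambda>u. h a * turn (u * of_int n)) has_integral h a * 0) {a..b}"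
      by (rule has_integral_mult_right)
    moreover have "F integrable_on {a..b}"
      by (rule integrable_continuous_interval) (rule continuous_on_subset[OF contF sub(1)])
    ultimately have "((\<lambda>u. F u - h a * turn (u * of_int n)) has_integral integral {a..b} F - h a * 0) {a..b}"
      by (intro has_integral_diff integrable_integral)
    then have "norm (integral {a..b} F - h a * 0) \<le> e * measure lborel {a..b}"
    proof (rule has_integral_bound_real[rotated 2])
      have "norm (h a - h a) \<le> e"
        by (rule osc) (use ab in auto)
      then show "0 \<le> e"
        by simp
    next
      fix u assume u: "u \<in> {a..b} - {}"
      have "F u - h a * turn (u * of_int n) = (h u - h a) * turn (of_int n * u)"
        by (simp add: F_def algebra_simps)
      moreover have "norm (h u - h a) \<le> e"
        by (rule osc) (use ab u in auto)
      ultimately show "norm (F u - h a * turn (u * of_int n)) \<le> e"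
        by (simp add: norm_mult)
    qed simp
    moreover have "integral {0..b} F = integral {0..a} F + integral {a..b} F"
      by (rule Henstock_Kurzweil_Integration.integral_combine[symmetric])
        (use ab in \<open>auto intro!: integrable_continuous_interval continuous_on_subset[OF contF sub(2)]\<close>)
    moreover have "norm (integral {0..a} F) \<le> e * a"
      using Suc unfolding a_def by simp
    ultimately have "norm (integral {0..b} F) \<le> e * a + e * (b - a)"
      using norm_triangle_ineq[of "integral {0..a} F" "integral {a..b} F"] ab(2) by simp
    then show ?case
      by (simp add: a_def b_def algebra_simps)
  qed simp
  from this[of L] show ?thesis
    using L(1) by (simp add: F_def[abs_def])
qed

text \<open>Uniform continuity makes the oscillation of \<open>h\<close> over one period small. A
  general sequence \<open>n\<close> serves frequencies tending to either infinity.\<close>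

lemma riemann_lebesgue:
  fixes h :: "real \<Rightarrow> complex" and n :: "nat \<Rightarrow> int"
  assumes cont: "continuous_on {0..1} h" and n: "\<And>k. int k \<le> \<bar>n k\<bar>"
  shows "(\<lambda>k. integral {0..1} (\<lambda>u. h u * turn (of_int (n k) * u))) \<longlonglongrightarrow> 0"
proof (rule LIMSEQ_I)
  fix e :: real assume "e > 0"
  have "uniformly_continuous_on {0..1} h"
    using cont by (rule compact_uniformly_continuous) simp
  then obtain d where d: "d > 0"
      "\<And>u v. u \<in> {0..1} \<Longrightarrow> v \<in> {0..1} \<Longrightarrow> dist u v < d \<Longrightarrow> dist (h u) (h v) < e / 2"
    using \<open>e > 0\<close> unfolding uniformly_continuous_on_def by (metis half_gt_zero)
  obtain k0 where k0: "1 / real (Suc k0) < d"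
    using nat_approx_posE[OF d(1)] by blast
  have "norm (integral {0..1} (\<lambda>u. h u * turn (of_int (n k) * u))) \<le> e / 2" if k: "k \<ge> Suc k0" for k
  proof (rule norm_fourier_coefficient_le[OF cont])
    show "n k \<noteq> 0"
      using n[of k] k by auto
    have "real (Suc k0) \<le> \<bar>real_of_int (n k)\<bar>"
      using n[of k] k by linarith
    then have "1 / \<bar>real_of_int (n k)\<bar> \<le> 1 / real (Suc k0)"
      by (intro divide_left_mono) auto
    then show "norm (h u - h v) \<le> e / 2"
      if "u \<in> {0..1}" "v \<in> {0..1}" "\<bar>u - v\<bar> \<le> 1 / \<bar>n k\<bar>" for u v
      using d(2)[of u v] that k0 by (simp add: dist_norm)
  qed
  then show "\<exists>k0. \<forall>k\<ge>k0. norm (integral {0..1} (\<lambda>u. h u * turn (of_int (n k) * u)) - 0) < e"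
    using \<open>e > 0\<close> by (intro exI[of _ "Suc k0"] allI impI) (fastforce intro: le_less_trans)
qed

section \<open>The Dirichlet kernel and the Fourier series at interior points\<close>

lemma turn_dirichlet_kernel:
  "(turn v - 1) * (\<Sum>n=-int K..int K. turn (of_int n * v)) = turn (real (Suc K) * v) - turn (- (real K * v))"
proof (induction K)
  case 0
  show ?case by simp
next
  case (Suc K)
  have "{- int (Suc K)..int (Suc K)} = insert (- int (Suc K)) (insert (int (Suc K)) {- int K..int K})"
    by auto
  then have "(\<Sum>n=-int (Suc K)..int (Suc K). turn (of_int n * v))
      = turn (- (real (Suc K) * v)) + turn (real (Suc K) * v) + (\<Sum>n=-int K..int K. turn (of_int n * v))"
    by (simp add: algebra_simps)
  moreover have "turn v * turn (real (Suc K) * v) = turn (real (Suc (Suc K)) * v)"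
    "turn v * turn (- (real (Suc K) * v)) = turn (- (real K * v))"
    by (simp_all add: turn_add[symmetric] algebra_simps)
  ultimately show ?case
    using Suc by (simp add: distrib_left left_diff_distrib)
qed

text \<open>Each coefficient is an integral over \<open>[0, 1]\<close>; taking the finite sum inside
  produces the Dirichlet kernel at \<open>u - y\<close>.\<close>

lemma bilateral_partial_sum_unit_band:
  "bilateral_partial_sum (\<lambda>n. unit_band (x + of_int n) * turn (- (of_int n * y))) K
    = integral {0..1} (\<lambda>u. turn (u * x) * (\<Sum>n=-int K..int K. turn (of_int n * (u - y))))"
proof -
  have "((\<lambda>u. turn (u * (x + of_int n)) * turn (- (of_int n * y))) has_integral
      unit_band (x + of_int n) * turn (- (of_int n * y))) {0..1}" for n
    unfolding unit_band_def
    by (intro has_integral_mult_left integrable_integral integrable_continuous_interval continuous_intros)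
  then have "((\<lambda>u. \<Sum>n=-int K..int K. turn (u * (x + of_int n)) * turn (- (of_int n * y))) has_integral
      bilateral_partial_sum (\<lambda>n. unit_band (x + of_int n) * turn (- (of_int n * y))) K) {0..1}"
    unfolding bilateral_partial_sum_def by (intro has_integral_sum) auto
  moreover have "turn (u * (x + of_int n)) * turn (- (of_int n * y)) = turn (u * x) * turn (of_int n * (u - y))" for u n
    by (simp add: turn_add[symmetric] algebra_simps)
  ultimately show ?thesis
    by (simp add: sum_distrib_left integral_unique)
qed

text \<open>
  The symmetric partial sums are the Fourier partial sums at \<open>y\<close> of \<open>u \<mapsto> turn (x * u)\<close> on \<open>[0, 1]\<close>.
  Dividing the increment of this function by \<open>turn (u - y) - 1\<close> leaves a continuous function \<open>h\<close>,
  and what is left of the Dirichlet kernel are two exponentials of high frequency.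
\<close>

lemma unit_band_series_limit_interior:
  assumes "0 < y" "y < 1"
  shows "bilateral_partial_sum (\<lambda>n. unit_band (x + of_int n) * turn (- (of_int n * y))) \<longlonglongrightarrow> turn (x * y)"
proof -
  \<comment> \<open>By \<open>turn_minus_1\<close>, this is the increment of
    \<open>turn (x * u)\<close> divided by \<open>turn (u - y) - 1\<close>, with the singularity at
    \<open>u = y\<close> removed; the factor \<open>x\<close> is what remains of the linear
    factors.\<close>
  define h where "h u = turn (x * y) * x * unit_band (x * (u - y)) / unit_band (u - y)" for u
  define D where "D K u = (\<Sum>n=-int K..int K. turn (of_int n * (u - y)))" for K u
  define c where "c n = integral {0..1} (\<lambda>u. h u * turn (of_int n * u))" for n :: int
  let ?S = "\<lambda>x. bilateral_partial_sum (\<lambda>n. unit_band (x + of_int n) * turn (- (of_int n * y)))"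
  \<comment> \<open>Here \<open>y\<close> must be interior: then \<open>u - y\<close> stays strictly
    between -1 and 1, whereas at an end point the denominator would vanish at the opposite
    end.\<close>
  have h: "continuous_on {0..1} h"
    unfolding h_def by (intro continuous_intros) (use assms in \<open>auto intro!: unit_band_nonzero\<close>)
  have contD: "continuous_on {0..1} (D K)" for K
    unfolding D_def by (intro continuous_intros)
  have quot: "h u * (turn (u - y) - 1) = turn (u * x) - turn (x * y)" if "u \<in> {0..1}" for u
  proof -
    have "unit_band (u - y) \<noteq> 0"
      using assms that by (intro unit_band_nonzero) auto
    then have "h u * (turn (u - y) - 1) = turn (x * y) * (turn (x * (u - y)) - 1)"
      unfolding turn_minus_1 by (simp add: h_def field_simps)
    then show ?thesis
      by (simp add: right_diff_distrib turn_add[symmetric] algebra_simps)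
  qed
  have split: "(turn (u * x) - turn (x * y)) * D K u
      = turn (- (real (Suc K) * y)) * (h u * turn (of_int (int (Suc K)) * u))
        - turn (real K * y) * (h u * turn (of_int (- int K) * u))" if "u \<in> {0..1}" for u K
  proof -
    have "(turn (u * x) - turn (x * y)) * D K u = h u * (turn (real (Suc K) * (u - y)) - turn (- (real K * (u - y))))"
      unfolding D_def by (simp only: quot[OF that, symmetric] mult.assoc turn_dirichlet_kernel)
    moreover have "turn (real (Suc K) * (u - y)) = turn (- (real (Suc K) * y)) * turn (of_int (int (Suc K)) * u)"
      "turn (- (real K * (u - y))) = turn (real K * y) * turn (of_int (- int K) * u)"
      by (simp_all add: turn_add[symmetric] algebra_simps)
    ultimately show ?thesis
      by (simp add: right_diff_distrib mult_ac)
  qed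
  have diff: "?S x K - turn (x * y) = turn (- (real (Suc K) * y)) * c (int (Suc K)) - turn (real K * y) * c (- int K)" for K
  proof -
    \<comment> \<open>For \<open>x = 0\<close> only the term \<open>n = 0\<close> survives. Thus the
      kernel has integral 1, and \<open>turn (x * y)\<close> can be put under the same
      integral.\<close>
    have "?S 0 K = (\<Sum>n\<in>{-int K..int K}. if n = 0 then 1 else 0)"
      unfolding bilateral_partial_sum_def by (intro sum.cong) (auto simp: unit_band_of_int)
    then have "?S 0 K = 1"
      by simp
    then have "?S x K - turn (x * y) = ?S x K - turn (x * y) * ?S 0 K"
      by simp
    also have "\<dots> = integral {0..1} (\<lambda>u. turn (u * x) * D K u - turn (x * y) * D K u)"
      unfolding bilateral_partial_sum_unit_band D_def[symmetric]
      by (subst integral_diff) (auto intro!: integrable_continuous_interval continuous_intros contD)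
    also have "\<dots> = integral {0..1} (\<lambda>u. turn (- (real (Suc K) * y)) * (h u * turn (of_int (int (Suc K)) * u))
        - turn (real K * y) * (h u * turn (of_int (- int K) * u)))"
      by (rule integral_cong) (simp only: split left_diff_distrib[symmetric])
    also have "\<dots> = turn (- (real (Suc K) * y)) * c (int (Suc K)) - turn (real K * y) * c (- int K)"
      unfolding c_def integral_mult_right[symmetric]
      by (rule integral_diff) (auto intro!: integrable_continuous_interval continuous_intros h)
    finally show ?thesis .
  qed
  have "(\<lambda>K. c (int (Suc K))) \<longlonglongrightarrow> 0" "(\<lambda>K. c (- int K)) \<longlonglongrightarrow> 0"
    unfolding c_def by (rule riemann_lebesgue[OF h], simp)+
  \<comment> \<open>The phase factors vary with \<open>K\<close> but have modulus 1, so the limits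
    are transferred through norms.\<close>
  then have "(\<lambda>K. norm (c (int (Suc K)))) \<longlonglongrightarrow> 0" "(\<lambda>K. norm (c (- int K))) \<longlonglongrightarrow> 0"
    by (simp_all only: tendsto_norm_zero_iff)
  then have "(\<lambda>K. norm (turn (- (real (Suc K) * y)) * c (int (Suc K)))) \<longlonglongrightarrow> 0"
    "(\<lambda>K. norm (turn (real K * y) * c (- int K))) \<longlonglongrightarrow> 0"
    by (simp_all only: norm_mult norm_turn mult_1)
  then have "(\<lambda>K. turn (- (real (Suc K) * y)) * c (int (Suc K))) \<longlonglongrightarrow> 0"
    "(\<lambda>K. turn (real K * y) * c (- int K)) \<longlonglongrightarrow> 0"
    by (simp_all only: tendsto_norm_zero_iff)
  from tendsto_diff[OF this] have "(\<lambda>K. ?S x K - turn (x * y)) \<longlonglongrightarrow> 0"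
    by (simp add: diff)
  then show ?thesis
    using LIM_zero_iff by blast
qed

section \<open>Symmetric summation over the integers\<close>

lemma bilateral_partial_sum_0 [simp]: "bilateral_partial_sum f 0 = f 0"
  by (simp add: bilateral_partial_sum_def)

lemma bilateral_partial_sum_Suc [simp]:
  "bilateral_partial_sum f (Suc K) = bilateral_partial_sum f K + f (int (Suc K)) + f (- int (Suc K))"
proof -
  have "{- int (Suc K)..int (Suc K)} = insert (- int (Suc K)) (insert (int (Suc K)) {- int K..int K})"
    by auto
  then show ?thesis
    by (simp add: bilateral_partial_sum_def algebra_simps)
qed

lemma bilateral_partial_sum_mult:
  "bilateral_partial_sum (\<lambda>n. c * f n) = (\<lambda>K. c * bilateral_partial_sum f K)"
  by (simp add: bilateral_partial_sum_def fun_eq_iff sum_distrib_left)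

lemma bilateral_limit_mult:
  "bilateral_partial_sum f \<longlonglongrightarrow> S \<Longrightarrow> bilateral_partial_sum (\<lambda>n. c * f n) \<longlonglongrightarrow> c * S"
  unfolding bilateral_partial_sum_mult by (intro tendsto_intros)

lemma bilateral_limit_sum:
  assumes "\<And>i. i \<in> I \<Longrightarrow> bilateral_partial_sum (f i) \<longlonglongrightarrow> S i"
  shows "bilateral_partial_sum (\<lambda>n. \<Sum>i\<in>I. f i n) \<longlonglongrightarrow> (\<Sum>i\<in>I. S i)"
proof -
  have "bilateral_partial_sum (\<lambda>n. \<Sum>i\<in>I. f i n) = (\<lambda>K. \<Sum>i\<in>I. bilateral_partial_sum (f i) K)"
    by (simp add: bilateral_partial_sum_def fun_eq_iff sum.swap[of _ I])
  then show ?thesis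
    using assms by (simp add: tendsto_sum)
qed

lemma bilateral_sum_eq: "bilateral_partial_sum f \<longlonglongrightarrow> S \<Longrightarrow> bilateral_sum f = S"
  by (simp add: bilateral_sum_def limI)

lemma zak_eq: "bilateral_partial_sum (zak_term T x \<tau> \<nu>) \<longlonglongrightarrow> S \<Longrightarrow> zak T x \<tau> \<nu> = of_real (sqrt T) * S"
  by (simp add: zak_def bilateral_sum_eq)

lemma bilateral_limit_finite:
  assumes "finite A" "\<And>n. n \<notin> A \<Longrightarrow> f n = 0"
  shows "bilateral_partial_sum f \<longlonglongrightarrow> sum f A"
proof -
  \<comment> \<open>Any common bound of the absolute values will do; the sum also covers an empty
    \<open>A\<close>.\<close>
  define K0 where "K0 = (\<Sum>n\<in>A. nat \<bar>n\<bar>)"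
  have K0: "nat \<bar>n\<bar> \<le> K0" if "n \<in> A" for n
    unfolding K0_def using that \<open>finite A\<close> by (intro member_le_sum) auto
  have "bilateral_partial_sum f K = sum f A" if "K \<ge> K0" for K
    unfolding bilateral_partial_sum_def
  proof (rule sum.mono_neutral_right)
    show "A \<subseteq> {- int K..int K}"
      using K0 that by fastforce
  qed (use assms in auto)
  then have "\<forall>\<^sub>F K in sequentially. sum f A = bilateral_partial_sum f K"
    unfolding eventually_sequentially by metis
  then show ?thesis
    by (rule Lim_transform_eventually[OF tendsto_const])
qed

text \<open>The summation range becomes \<open>- K - 1\<close> to \<open>K - 1\<close>: one term
  enters at the left and one leaves at the right.\<close>

lemma bilateral_partial_sum_shift:
  "bilateral_partial_sum (\<lambda>n. f (n - 1)) K
    = bilateral_partial_sum f K + f (- int (Suc K)) - f (int K)"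
  by (induction K) (simp_all add: algebra_simps)

text \<open>Symmetric sums are not shift invariant in general. Each unit shift adds two boundary
  terms, which the first two assumptions send to 0.\<close>

lemma bilateral_limit_shift:
  assumes pos: "(\<lambda>k. f (int k)) \<longlonglongrightarrow> 0" and neg: "(\<lambda>k. f (- int k)) \<longlonglongrightarrow> 0"
    and f: "bilateral_partial_sum f \<longlonglongrightarrow> S"
  shows "bilateral_partial_sum (\<lambda>n. f (n - int m)) \<longlonglongrightarrow> S"
proof (induction m)
  case (Suc m)
  have "(\<lambda>k. f (- int (k + (m + 1)))) \<longlonglongrightarrow> 0"
    by (rule LIMSEQ_ignore_initial_segment[OF neg])
  then have neg': "(\<lambda>k. f (- int (Suc k) - int m)) \<longlonglongrightarrow> 0"
    by (simp add: algebra_simps)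
  have pos': "(\<lambda>k. f (int k - int m)) \<longlonglongrightarrow> 0"
    by (rule LIMSEQ_offset[of _ m]) (simp add: pos)
  have "(\<lambda>K. bilateral_partial_sum (\<lambda>n. f (n - int m)) K + f (- int (Suc K) - int m) - f (int K - int m))
      \<longlonglongrightarrow> S + 0 - 0"
    by (intro tendsto_intros Suc neg' pos')
  moreover have "bilateral_partial_sum (\<lambda>n. f (n - int (Suc m))) K
      = bilateral_partial_sum (\<lambda>n. f (n - int m)) K + f (- int (Suc K) - int m) - f (int K - int m)" for K
    using bilateral_partial_sum_shift[of "\<lambda>n. f (n - int m)" K] by (simp add: algebra_simps)
  ultimately show ?case
    by simp
qed (simp add: f)

section \<open>Decay of \<open>unit_band\<close> and convergence of its series at all points\<close>

text \<open>The bound \<open>1 / \<bar>z\<bar>\<close> gives the decay in both directions, which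
  controls the boundary terms of a shift.\<close>

lemma unit_band_null_sequence:
  assumes "\<And>k. int k \<le> \<bar>n k\<bar>"
  shows "(\<lambda>k. unit_band (x + of_int (n k))) \<longlonglongrightarrow> 0"
proof (rule Lim_null_comparison)
  have "filterlim (\<lambda>k. - \<bar>x\<bar> + real k) at_top sequentially"
    by (rule filterlim_tendsto_add_at_top[OF tendsto_const filterlim_real_sequentially])
  then show "(\<lambda>k. inverse (- \<bar>x\<bar> + real k)) \<longlonglongrightarrow> 0"
    by (rule tendsto_inverse_0_at_top)
  \<comment> \<open>The bound \<open>real k - \<bar>x\<bar>\<close> from the triangle inequality is
    positive only from here on.\<close>
  have "\<forall>\<^sub>F k in sequentially. \<bar>x\<bar> < real k"
    using filterlim_real_sequentially by (simp add: filterlim_at_top_dense)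
  then show "\<forall>\<^sub>F k in sequentially. norm (unit_band (x + of_int (n k))) \<le> inverse (- \<bar>x\<bar> + real k)"
  proof eventually_elim
    case (elim k)
    have le: "- \<bar>x\<bar> + real k \<le> \<bar>x + of_int (n k)\<bar>"
      using assms[of k] by linarith
    then have "norm (unit_band (x + of_int (n k))) \<le> 1 / \<bar>x + of_int (n k)\<bar>"
      using elim by (intro norm_unit_band_le) auto
    also have "\<dots> \<le> inverse (- \<bar>x\<bar> + real k)"
      using le elim by (simp add: field_simps)
    finally show ?case .
  qed
qed

text \<open>\<open>unit_band\<close> vanishes at nonzero integers, so a single term survives, for
  every \<open>y\<close>.\<close>

lemma unit_band_series_limit_integer:
  assumes "x \<in> \<int>"
  shows "bilateral_partial_sum (\<lambda>n. unit_band (x + of_int n) * turn (- (of_int n * y))) \<longlonglongrightarrow> turn (x * y)"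
proof -
  obtain i where i: "x = of_int i"
    using assms by (auto elim: Ints_cases)
  have "unit_band (x + of_int n) = (if n = - i then 1 else 0)" for n
    using unit_band_of_int[of "i + n"] by (simp add: i eq_neg_iff_add_eq_0 add.commute)
  then have "bilateral_partial_sum (\<lambda>n. unit_band (x + of_int n) * turn (- (of_int n * y)))
      \<longlonglongrightarrow> (\<Sum>n\<in>{- i}. unit_band (x + of_int n) * turn (- (of_int n * y)))"
    by (intro bilateral_limit_finite) auto
  then show ?thesis
    by (simp add: i)
qed

text \<open>At \<open>y = 0\<close> the periodic extension of \<open>turn (x * u)\<close> from
  \<open>[0, 1)\<close> has left limit \<open>turn x\<close> and right limit 1; it is free of a jump
  exactly for integer \<open>x\<close>.\<close>

lemma unit_band_series_limit:
  assumes "0 \<le> y" "y < 1" "y \<noteq> 0 \<or> x \<in> \<int>"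
  shows "bilateral_partial_sum (\<lambda>n. unit_band (x + of_int n) * turn (- (of_int n * y))) \<longlonglongrightarrow> turn (x * y)"
proof (cases "y = 0")
  case True
  then show ?thesis
    using assms(3) by (intro unit_band_series_limit_integer) simp
next
  case False
  then show ?thesis
    using assms by (intro unit_band_series_limit_interior) auto
qed

text \<open>Pairing \<open>n\<close> with \<open>- n\<close> turns the terms \<open>1 / (x + n)\<close> into \<open>2 * x / (x\<^sup>2 - n\<^sup>2)\<close>.\<close>

lemma unit_band_series_convergent:
  assumes "x \<notin> \<int>"
  shows "bilateral_convergent (\<lambda>n. unit_band (x + of_int n))"
proof -
  define g where "g k = 1 / (x + real (Suc k)) + 1 / (x - real (Suc k))" for k
  have nz: "x + of_int n \<noteq> 0" for n
  proof
    assume "x + of_int n = 0"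
    then have "x = of_int (- n)"
      by simp
    then show False
      using assms by (metis Ints_of_int)
  qed
  have bound: "norm (g k) \<le> 4 * \<bar>x\<bar> * inverse (real (Suc k) ^ 2)" if "2 * \<bar>x\<bar> \<le> real (Suc k)" for k
  proof -
    define m where "m = real (Suc k)"
    have m: "m > 0" "x + m \<noteq> 0" "x - m \<noteq> 0"
      using nz[of "int (Suc k)"] nz[of "- int (Suc k)"] by (auto simp: m_def)
    \<comment> \<open>Such \<open>m\<close> keep \<open>m\<^sup>2 - x\<^sup>2\<close> above
      \<open>m\<^sup>2 / 2\<close>, which gives the constant 4.\<close>
    have "(2 * \<bar>x\<bar>) ^ 2 \<le> m ^ 2"
      using that unfolding m_def by (intro power_mono) auto
    then have le: "4 * x\<^sup>2 \<le> m\<^sup>2"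
      by (simp add: power_mult_distrib)
    have "m\<^sup>2 > 0"
      using m(1) by simp
    have "g k = 2 * x / ((x + m) * (x - m))"
      unfolding g_def m_def[symmetric] using m by (simp add: field_simps)
    also have "(x + m) * (x - m) = - (m\<^sup>2 - x\<^sup>2)"
      by (simp add: algebra_simps power2_eq_square)
    finally have "norm (g k) = 2 * \<bar>x\<bar> / \<bar>m\<^sup>2 - x\<^sup>2\<bar>"
      by (simp add: abs_mult abs_minus_commute)
    also have "\<dots> \<le> 2 * \<bar>x\<bar> / (m\<^sup>2 / 2)"
    proof (rule divide_left_mono)
      show "m\<^sup>2 / 2 \<le> \<bar>m\<^sup>2 - x\<^sup>2\<bar>"
        using le \<open>m\<^sup>2 > 0\<close> by linarith
      then show "0 < \<bar>m\<^sup>2 - x\<^sup>2\<bar> * (m\<^sup>2 / 2)"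
        using \<open>m\<^sup>2 > 0\<close> by (intro mult_pos_pos) linarith+
    qed simp
    finally show ?thesis
      by (simp add: m_def field_simps)
  qed
  have "summable (\<lambda>k. inverse (real k ^ 2))"
    by (rule inverse_power_summable) simp
  then have "summable (\<lambda>k. 4 * \<bar>x\<bar> * inverse (real (Suc k) ^ 2))"
    by (subst (asm) summable_Suc_iff[symmetric]) (rule summable_mult)
  moreover have "\<forall>\<^sub>F k in sequentially. 2 * \<bar>x\<bar> \<le> real (Suc k)"
    using filterlim_real_sequentially[unfolded filterlim_at_top]
    by (rule allE[of _ "2 * \<bar>x\<bar>"]) (erule eventually_mono, simp)
  then have "\<forall>\<^sub>F k in sequentially. norm (g k) \<le> 4 * \<bar>x\<bar> * inverse (real (Suc k) ^ 2)"
    by eventually_elim (rule bound)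
  ultimately have "summable g"
    by (rule summable_comparison_test_ev[rotated])
  then have "(\<lambda>K. of_real (1 / x + (\<Sum>k<K. g k))) \<longlonglongrightarrow> (of_real (1 / x + suminf g) :: complex)"
    by (intro tendsto_of_real tendsto_add tendsto_const summable_LIMSEQ)
  then have "(\<lambda>K. (turn x - 1) / (2 * pi * \<i>) * of_real (1 / x + (\<Sum>k<K. g k)))
      \<longlonglongrightarrow> (turn x - 1) / (2 * pi * \<i>) * of_real (1 / x + suminf g)"
    by (intro tendsto_mult tendsto_const)
  moreover have "bilateral_partial_sum (\<lambda>n. unit_band (x + of_int n))
      = (\<lambda>K. (turn x - 1) / (2 * pi * \<i>) * of_real (1 / x + (\<Sum>k<K. g k)))"
  proof (rule ext)
    fix K
    \<comment> \<open>By periodicity the numerator \<open>turn (x + n) - 1\<close> is the same for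
      all \<open>n\<close>, leaving a real series of reciprocals.\<close>
    have term_eq: "unit_band (x + of_int n) = (turn x - 1) / (2 * pi * \<i>) * of_real (1 / (x + of_int n))" for n
      using nz[of n] by (simp add: unit_band_eq turn_add mult_ac)
    have "bilateral_partial_sum (\<lambda>n. of_real (1 / (x + of_int n))) K = of_real (1 / x + (\<Sum>k<K. g k))"
    proof (induction K)
      case (Suc K)
      have "1 / (x + of_int (int (Suc K))) + 1 / (x + of_int (- int (Suc K))) = g K"
        by (simp add: g_def)
      then show ?case
        unfolding bilateral_partial_sum_Suc Suc sum.lessThan_Suc
        by (simp only: of_real_add[symmetric] add.assoc)
    qed simp
    then show "bilateral_partial_sum (\<lambda>n. unit_band (x + of_int n)) K
        = (turn x - 1) / (2 * pi * \<i>) * of_real (1 / x + (\<Sum>k<K. g k))"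
      unfolding term_eq bilateral_partial_sum_mult by simp
  qed
  ultimately show ?thesis
    unfolding bilateral_convergent_def by (simp only: convergentI)
qed

section \<open>ZAK terms of the pulse and of the window\<close>

text \<open>Integer arguments of \<open>turn\<close> drop out twice: the sum over the bands does not
  depend on \<open>n\<close>, and \<open>\<nu> * T\<close> matters only through its fractional
  part.\<close>

lemma zak_term_band:
  assumes "T > 0" and s: "s = (\<lambda>t. integral {0..real M * (1 / T)} (\<lambda>f. cis (2 * pi * f * t)))"
  shows "zak_term T s \<tau> \<nu> n = of_real (1 / T) * (\<Sum>m<M. turn (real m * (\<tau> / T)))
      * (unit_band (\<tau> / T + of_int n) * turn (- (of_int n * frac (\<nu> * T))))"
proof -
  have t: "(\<tau> + of_int n * T) / T = \<tau> / T + of_int n"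
    using \<open>T > 0\<close> by (simp add: field_simps)
  have m: "turn (real m * (\<tau> / T + of_int n)) = turn (real m * (\<tau> / T))" for m
    using turn_of_int[of "int m * n"] by (simp add: distrib_left turn_add)
  have "- 2 * pi * of_int n * \<nu> * T = 2 * pi * (- (of_int n * frac (\<nu> * T)) + of_int (- (n * \<lfloor>\<nu> * T\<rfloor>)))"
    by (simp add: frac_def algebra_simps)
  then have "cis (- 2 * pi * of_int n * \<nu> * T) = turn (- (of_int n * frac (\<nu> * T)) + of_int (- (n * \<lfloor>\<nu> * T\<rfloor>)))"
    by (simp only: turn_def)
  also have "\<dots> = turn (- (of_int n * frac (\<nu> * T)))"
    unfolding turn_add turn_of_int by simp
  finally show ?thesis
    unfolding zak_term_def s integral_cis_band[OF \<open>T > 0\<close>] t m by simp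
qed

text \<open>The half-open window of length \<open>N * T\<close> meets a grid of step
  \<open>T\<close> in exactly \<open>N\<close> points; the floor gives the first index.\<close>

lemma mem_window_iff:
  assumes "T > 0"
  shows "0 \<le> \<tau> + of_int n * T \<and> \<tau> + of_int n * T < real N * T
      \<longleftrightarrow> n \<in> {- \<lfloor>\<tau> / T\<rfloor>..<- \<lfloor>\<tau> / T\<rfloor> + int N}"
proof -
  have "0 \<le> \<tau> + of_int n * T \<longleftrightarrow> of_int (- n) \<le> \<tau> / T"
    using assms by (simp add: field_simps) linarith
  moreover have "\<tau> + of_int n * T < real N * T \<longleftrightarrow> \<tau> / T < of_int (int N - n)"
    using assms by (simp add: field_simps)
  ultimately show ?thesis
    unfolding le_floor_iff[symmetric] floor_less_iff[symmetric] by auto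
qed

lemma sum_int_interval: "(\<Sum>n\<in>{a..<a + int N}. f n) = (\<Sum>m<N. f (a + int m))"
proof (induction N)
  case (Suc N)
  have "{a..<a + int (Suc N)} = insert (a + int N) {a..<a + int N}"
    by auto
  then show ?case
    using Suc by (simp add: add.commute)
qed simp

section \<open>The ZAK representations of the window, the pulse and the filtered pulsone\<close>

theorem theorem2:
  fixes T \<Delta>f \<tau>\<^sub>0 \<nu>\<^sub>0 :: real
    and M N :: nat
    and q s \<psi> :: "real \<Rightarrow> complex"
  assumes "T > 0" and "\<Delta>f = 1 / T"
    and "M > 0" and "N > 0"
    and "0 \<le> \<tau>\<^sub>0" and "\<tau>\<^sub>0 < T"
    and "0 \<le> \<nu>\<^sub>0" and "\<nu>\<^sub>0 < \<Delta>f"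
    and q: "q = (\<lambda>t. if 0 \<le> t \<and> t < real N * T then 1 else 0)"
    and s: "s = (\<lambda>t. integral {0..real M * \<Delta>f} (\<lambda>f. cis (2 * pi * f * t)))"
    and \<psi>: "\<psi> = impulse_convolve (impulse_mult (pulsone T \<tau>\<^sub>0 \<nu>\<^sub>0) q) s"
  shows
    "(\<forall>t. \<psi> t = of_real (sqrt T) *
        (\<Sum>n<N. cis (2 * pi * \<nu>\<^sub>0 * real n * T) * s (t - \<tau>\<^sub>0 - real n * T)))
   \<and> (\<forall>\<tau> \<nu>. bilateral_convergent (zak_term T \<psi> \<tau> \<nu>)
          \<and> bilateral_convergent (zak_term T q \<tau> \<nu>)
          \<and> bilateral_convergent (zak_term T s \<tau> \<nu>))
   \<and> (\<forall>\<tau> \<nu>. zak T \<psi> \<tau> \<nu> = zak T q \<tau>\<^sub>0 (\<nu> - \<nu>\<^sub>0) * zak T s (\<tau> - \<tau>\<^sub>0) \<nu>)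
   \<and> (\<forall>\<tau> \<nu>. zak T q \<tau> \<nu> =
        of_real (sqrt T)
        * cis (2 * pi * \<nu> * of_int \<lfloor>\<tau> / T\<rfloor> * T)
        * cis (- pi * \<nu> * (real N - 1) * T)
        * of_real (sine_ratio N (pi * \<nu> * T)))
   \<and> (\<forall>\<tau> \<nu>. \<nu> / \<Delta>f \<notin> \<int> \<or> real M * \<tau> / T \<in> \<int> \<longrightarrow>
        zak T s \<tau> \<nu> =
        of_real (1 / sqrt T)
        * cis (2 * pi * \<nu> * \<tau>)
        * cis (- 2 * pi * of_int \<lfloor>\<nu> / \<Delta>f\<rfloor> * \<Delta>f * \<tau>)
        * cis (pi * (real M - 1) * \<Delta>f * \<tau>)
        * of_real (sine_ratio M (pi * \<Delta>f * \<tau>)))"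
proof (intro conjI allI impI)
  have \<Delta>f: "\<nu> / \<Delta>f = \<nu> * T" for \<nu>
    using \<open>T > 0\<close> by (simp add: \<open>\<Delta>f = 1 / T\<close>)
  have sqrt_T: "complex_of_real (sqrt T) * of_real (sqrt T) = of_real T"
    using \<open>T > 0\<close> by (simp flip: of_real_mult)
  have s': "s = (\<lambda>t. integral {0..real M * (1 / T)} (\<lambda>f. cis (2 * pi * f * t)))"
    by (simp add: s \<open>\<Delta>f = 1 / T\<close>)
  define G where "G \<tau> = (\<Sum>m<M. turn (real m * (\<tau> / T)))" for \<tau>
  note zak_term_s = zak_term_band[OF \<open>T > 0\<close> s', folded G_def]

  show \<psi>_eq: "\<psi> t = of_real (sqrt T) *
      (\<Sum>n<N. cis (2 * pi * \<nu>\<^sub>0 * real n * T) * s (t - \<tau>\<^sub>0 - real n * T))" for t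
  proof -
    define f where "f n = cis (2 * pi * \<nu>\<^sub>0 * of_int n * T) * (q (\<tau>\<^sub>0 + of_int n * T) * s (t - (\<tau>\<^sub>0 + of_int n * T)))"
      for n :: int
    \<comment> \<open>The delay lies in the first period, so the window keeps the impulses 0 to
      \<open>N - 1\<close>.\<close>
    have "\<lfloor>\<tau>\<^sub>0 / T\<rfloor> = 0"
      using \<open>0 \<le> \<tau>\<^sub>0\<close> \<open>\<tau>\<^sub>0 < T\<close> by (simp add: floor_eq_iff)
    then have q_at: "q (\<tau>\<^sub>0 + of_int n * T) = (if n \<in> {0..<0 + int N} then 1 else 0)" for n
      using mem_window_iff[OF \<open>T > 0\<close>, of \<tau>\<^sub>0 n N] by (simp add: q)
    have "bilateral_partial_sum f \<longlonglongrightarrow> sum f {0..<0 + int N}"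
      by (rule bilateral_limit_finite) (auto simp: f_def q_at)
    also have "sum f {0..<0 + int N} = (\<Sum>n<N. f (0 + int n))"
      by (rule sum_int_interval)
    also have "\<dots> = (\<Sum>n<N. cis (2 * pi * \<nu>\<^sub>0 * real n * T) * s (t - \<tau>\<^sub>0 - real n * T))"
      using q_at[of "int _"] by (intro sum.cong) (auto simp: f_def diff_diff_eq)
    finally have "bilateral_sum f = \<dots>"
      by (rule bilateral_sum_eq)
    then show ?thesis
      by (simp add: \<psi> impulse_convolve_def impulse_mult_def pulsone_def dirac_at_def f_def[abs_def])
  qed

  have q_limit: "bilateral_partial_sum (zak_term T q \<tau> \<nu>)
      \<longlonglongrightarrow> (\<Sum>m<N. cis (- 2 * pi * (real m - of_int \<lfloor>\<tau> / T\<rfloor>) * \<nu> * T))" for \<tau> \<nu>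
  proof -
    define F where "F = \<lfloor>\<tau> / T\<rfloor>"
    have q_at: "q (\<tau> + of_int n * T) = (if n \<in> {- F..<- F + int N} then 1 else 0)" for n
      using mem_window_iff[OF \<open>T > 0\<close>, of \<tau> n N] by (simp add: q F_def)
    have "bilateral_partial_sum (zak_term T q \<tau> \<nu>) \<longlonglongrightarrow> sum (zak_term T q \<tau> \<nu>) {- F..<- F + int N}"
      by (rule bilateral_limit_finite) (auto simp: zak_term_def q_at)
    also have "sum (zak_term T q \<tau> \<nu>) {- F..<- F + int N} = (\<Sum>m<N. zak_term T q \<tau> \<nu> (- F + int m))"
      by (rule sum_int_interval)
    also have "\<dots> = (\<Sum>m<N. cis (- 2 * pi * (real m - of_int F) * \<nu> * T))"
    proof (rule sum.cong)
      fix m assume "m \<in> {..<N}"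
      then have "q (\<tau> + of_int (- F + int m) * T) = 1"
        unfolding q_at by simp
      then show "zak_term T q \<tau> \<nu> (- F + int m) = cis (- 2 * pi * (real m - of_int F) * \<nu> * T)"
        unfolding zak_term_def by (simp add: algebra_simps)
    qed simp
    finally show ?thesis
      unfolding F_def .
  qed
  then show "bilateral_convergent (zak_term T q \<tau> \<nu>)" for \<tau> \<nu>
    unfolding bilateral_convergent_def convergent_def by blast

  show s_conv: "bilateral_convergent (zak_term T s \<tau> \<nu>)" for \<tau> \<nu>
  proof -
    define y where "y = frac (\<nu> * T)"
    have y: "0 \<le> y" "y < 1"
      by (auto simp: y_def frac_lt_1)
    have "bilateral_convergent (\<lambda>n. unit_band (\<tau> / T + of_int n) * turn (- (of_int n * y)))"
    proof (cases "y = 0 \<and> \<tau> / T \<notin> \<int>")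
      case True
      then show ?thesis
        using unit_band_series_convergent by simp
    next
      case False
      then have "bilateral_partial_sum (\<lambda>n. unit_band (\<tau> / T + of_int n) * turn (- (of_int n * y)))
          \<longlonglongrightarrow> turn (\<tau> / T * y)"
        using y by (intro unit_band_series_limit) auto
      then show ?thesis
        unfolding bilateral_convergent_def convergent_def by blast
    qed
    then obtain S where "bilateral_partial_sum (\<lambda>n. unit_band (\<tau> / T + of_int n) * turn (- (of_int n * y))) \<longlonglongrightarrow> S"
      unfolding bilateral_convergent_def convergent_def by blast
    from bilateral_limit_mult[OF this] show ?thesis
      unfolding bilateral_convergent_def convergent_def zak_term_s[abs_def] y_def by blast
  qed

  have \<psi>_limit: "bilateral_partial_sum (zak_term T \<psi> \<tau> \<nu>) \<longlonglongrightarrow>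
      (\<Sum>m<N. of_real (sqrt T) * cis (- 2 * pi * real m * (\<nu> - \<nu>\<^sub>0) * T) * bilateral_sum (zak_term T s (\<tau> - \<tau>\<^sub>0) \<nu>))"
    for \<tau> \<nu>
  proof -
    define f where "f = zak_term T s (\<tau> - \<tau>\<^sub>0) \<nu>"
    have null: "(\<lambda>k. f (n k)) \<longlonglongrightarrow> 0" if "\<And>k. int k \<le> \<bar>n k\<bar>" for n
    proof -
      have "(\<lambda>k. norm (of_real (1 / T) * G (\<tau> - \<tau>\<^sub>0)) * norm (unit_band ((\<tau> - \<tau>\<^sub>0) / T + of_int (n k)))) \<longlonglongrightarrow>
          norm (of_real (1 / T) * G (\<tau> - \<tau>\<^sub>0)) * norm (0 :: complex)"
        by (intro tendsto_intros unit_band_null_sequence that)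
      then have "(\<lambda>k. norm (f (n k))) \<longlonglongrightarrow> 0"
        unfolding f_def zak_term_s by (simp only: norm_mult norm_turn norm_zero mult_1_right mult_zero_right)
      then show ?thesis
        by (rule tendsto_norm_zero_cancel)
    qed
    have "bilateral_partial_sum f \<longlonglongrightarrow> bilateral_sum f"
      using s_conv unfolding f_def bilateral_convergent_def bilateral_sum_def by (simp add: convergent_LIMSEQ_iff)
    then have "bilateral_partial_sum (\<lambda>k. f (k - int m)) \<longlonglongrightarrow> bilateral_sum f" for m
      by (intro bilateral_limit_shift null) auto
    then have "bilateral_partial_sum
        (\<lambda>k. \<Sum>m<N. of_real (sqrt T) * cis (- 2 * pi * real m * (\<nu> - \<nu>\<^sub>0) * T) * f (k - int m))
      \<longlonglongrightarrow> (\<Sum>m<N. of_real (sqrt T) * cis (- 2 * pi * real m * (\<nu> - \<nu>\<^sub>0) * T) * bilateral_sum f)"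
      by (intro bilateral_limit_sum bilateral_limit_mult)
    moreover have "zak_term T \<psi> \<tau> \<nu>
        = (\<lambda>k. \<Sum>m<N. of_real (sqrt T) * cis (- 2 * pi * real m * (\<nu> - \<nu>\<^sub>0) * T) * f (k - int m))"
    proof (rule ext)
      fix k
      have arg: "\<tau> + of_int k * T - \<tau>\<^sub>0 - real m * T = \<tau> - \<tau>\<^sub>0 + of_int (k - int m) * T" for m
        by (simp add: algebra_simps)
      \<comment> \<open>Reindexing by \<open>k - m\<close> turns the delay of the copy of
        \<open>s\<close> into a phase, which joins the modulation by \<open>\<nu>\<^sub>0\<close>
        and leaves the frequency \<open>\<nu> - \<nu>\<^sub>0\<close>.\<close>
      have phase: "cis (2 * pi * \<nu>\<^sub>0 * real m * T) * cis (- 2 * pi * of_int k * \<nu> * T)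
          = cis (- 2 * pi * real m * (\<nu> - \<nu>\<^sub>0) * T) * cis (- 2 * pi * of_int (k - int m) * \<nu> * T)" for m
        by (simp add: cis_mult algebra_simps)
      have "zak_term T \<psi> \<tau> \<nu> k = (\<Sum>m<N. of_real (sqrt T) * s (\<tau> - \<tau>\<^sub>0 + of_int (k - int m) * T)
          * (cis (2 * pi * \<nu>\<^sub>0 * real m * T) * cis (- 2 * pi * of_int k * \<nu> * T)))"
        unfolding zak_term_def \<psi>_eq arg by (simp only: sum_distrib_left sum_distrib_right mult_ac)
      also have "\<dots> = (\<Sum>m<N. of_real (sqrt T) * cis (- 2 * pi * real m * (\<nu> - \<nu>\<^sub>0) * T) * f (k - int m))"
        unfolding phase f_def zak_term_def by (simp only: mult_ac)
      finally show "zak_term T \<psi> \<tau> \<nu> k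
        = (\<Sum>m<N. of_real (sqrt T) * cis (- 2 * pi * real m * (\<nu> - \<nu>\<^sub>0) * T) * f (k - int m))" .
    qed
    ultimately show ?thesis
      by (simp only: f_def)
  qed
  then show "bilateral_convergent (zak_term T \<psi> \<tau> \<nu>)" for \<tau> \<nu>
    unfolding bilateral_convergent_def convergent_def by blast

  show "zak T \<psi> \<tau> \<nu> = zak T q \<tau>\<^sub>0 (\<nu> - \<nu>\<^sub>0) * zak T s (\<tau> - \<tau>\<^sub>0) \<nu>" for \<tau> \<nu>
  proof -
    \<comment> \<open>With floor 0, the weights of the shifted copies are exactly the terms for
      \<open>q\<close>. The series of \<open>s\<close> enters through its sum alone, so the identity
      includes the jump points.\<close>
    have "\<lfloor>\<tau>\<^sub>0 / T\<rfloor> = 0"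
      using \<open>0 \<le> \<tau>\<^sub>0\<close> \<open>\<tau>\<^sub>0 < T\<close> by (simp add: floor_eq_iff)
    then have "zak T q \<tau>\<^sub>0 (\<nu> - \<nu>\<^sub>0) = of_real (sqrt T) * (\<Sum>m<N. cis (- 2 * pi * real m * (\<nu> - \<nu>\<^sub>0) * T))"
      using zak_eq[OF q_limit[of \<tau>\<^sub>0 "\<nu> - \<nu>\<^sub>0"]] by simp
    then show ?thesis
      unfolding zak_eq[OF \<psi>_limit] by (simp add: zak_def sum_distrib_left sum_distrib_right mult_ac)
  qed

  show "zak T q \<tau> \<nu> = of_real (sqrt T) * cis (2 * pi * \<nu> * of_int \<lfloor>\<tau> / T\<rfloor> * T)
      * cis (- pi * \<nu> * (real N - 1) * T) * of_real (sine_ratio N (pi * \<nu> * T))" for \<tau> \<nu>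
  proof -
    define x where "x = pi * \<nu> * T"
    define a where "a = 2 * pi * \<nu> * of_int \<lfloor>\<tau> / T\<rfloor> * T"
    \<comment> \<open>The sum is read backwards to get positive frequencies; half of the phase
      \<open>- 2 * (N - 1) * x\<close> then cancels against that of the ratio of sines.\<close>
    have "cis (- 2 * pi * (real m - of_int \<lfloor>\<tau> / T\<rfloor>) * \<nu> * T)
        = cis a * cis (- 2 * (real N - 1) * x) * cis (2 * real (N - Suc m) * x)" if "m < N" for m
      using that by (simp add: cis_mult of_nat_diff a_def x_def algebra_simps)
    then have "(\<Sum>m<N. cis (- 2 * pi * (real m - of_int \<lfloor>\<tau> / T\<rfloor>) * \<nu> * T))
        = cis a * cis (- 2 * (real N - 1) * x) * (\<Sum>m<N. cis (2 * real (N - Suc m) * x))"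
      by (simp add: sum_distrib_left)
    also have "(\<Sum>m<N. cis (2 * real (N - Suc m) * x)) = (\<Sum>m<N. cis (2 * real m * x))"
      by (rule sum.nat_diff_reindex)
    also have "cis a * cis (- 2 * (real N - 1) * x) * \<dots>
        = cis a * (cis (- 2 * (real N - 1) * x) * cis ((real N - 1) * x)) * of_real (sine_ratio N x)"
      unfolding sum_cis_eq_sine_ratio by simp
    also have "cis (- 2 * (real N - 1) * x) * cis ((real N - 1) * x) = cis (- pi * \<nu> * (real N - 1) * T)"
      by (simp add: cis_mult x_def algebra_simps)
    finally show ?thesis
      unfolding zak_eq[OF q_limit] a_def x_def by (simp only: mult.assoc)
  qed

  show "zak T s \<tau> \<nu> = of_real (1 / sqrt T) * cis (2 * pi * \<nu> * \<tau>)
      * cis (- 2 * pi * of_int \<lfloor>\<nu> / \<Delta>f\<rfloor> * \<Delta>f * \<tau>) * cis (pi * (real M - 1) * \<Delta>f * \<tau>)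
      * of_real (sine_ratio M (pi * \<Delta>f * \<tau>))"
    if generic: "\<nu> / \<Delta>f \<notin> \<int> \<or> real M * \<tau> / T \<in> \<int>" for \<tau> \<nu>
  proof -
    define x where "x = \<tau> / T"
    define y where "y = frac (\<nu> * T)"
    have y: "0 \<le> y" "y < 1"
      by (auto simp: y_def frac_lt_1)
    have lim: "bilateral_partial_sum (\<lambda>n. G \<tau> * (unit_band (x + of_int n) * turn (- (of_int n * y))))
        \<longlonglongrightarrow> G \<tau> * turn (x * y)"
    proof (cases "y = 0 \<and> x \<notin> \<int>")
      case True
      \<comment> \<open>At a jump \<open>generic\<close> leaves only the case of integer
        \<open>M * x\<close>. Then \<open>turn x\<close> is an \<open>M\<close>-th root of unity
        other than 1, so the band sum \<open>G \<tau>\<close> vanishes and with it every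
        term.\<close>
      then have "turn (real M * x) = 1" "turn x \<noteq> 1"
        using generic by (auto simp: turn_eq_1_iff x_def y_def \<Delta>f frac_eq_0_iff)
      then have "G \<tau> = 0"
        using power_diff_1_eq[of "turn x" M] by (simp add: G_def turn_power x_def)
      then show ?thesis
        by (simp add: bilateral_partial_sum_def[abs_def])
    next
      case False
      then show ?thesis
        using y by (intro bilateral_limit_mult unit_band_series_limit) auto
    qed
    have "zak_term T s \<tau> \<nu>
        = (\<lambda>n. of_real (1 / T) * (G \<tau> * (unit_band (x + of_int n) * turn (- (of_int n * y)))))"
      unfolding zak_term_s[abs_def] x_def y_def by (simp only: mult.assoc)
    then have "zak T s \<tau> \<nu> = of_real (sqrt T) * (of_real (1 / T) * (G \<tau> * turn (x * y)))"
      using zak_eq bilateral_limit_mult[OF lim, of "of_real (1 / T)"] by simp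
    also have "G \<tau> = cis (pi * (real M - 1) * \<Delta>f * \<tau>) * of_real (sine_ratio M (pi * \<Delta>f * \<tau>))"
      using sum_cis_eq_sine_ratio[of "pi * \<Delta>f * \<tau>" M]
      by (simp add: G_def turn_def \<open>\<Delta>f = 1 / T\<close> mult_ac)
    \<comment> \<open>The fractional part in \<open>y\<close> splits into \<open>\<nu> * T\<close>
      minus its floor, which gives the two phases.\<close>
    also have "turn (x * y) = cis (2 * pi * \<nu> * \<tau>) * cis (- 2 * pi * of_int \<lfloor>\<nu> / \<Delta>f\<rfloor> * \<Delta>f * \<tau>)"
      using \<open>T > 0\<close> unfolding \<Delta>f by (simp add: turn_def cis_mult x_def y_def frac_def \<open>\<Delta>f = 1 / T\<close> field_simps)
    also have "complex_of_real (sqrt T) * (of_real (1 / T) * z) = of_real (1 / sqrt T) * z" for z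
      using \<open>T > 0\<close> by (simp add: real_sqrt_divide field_simps flip: sqrt_T)
    finally show ?thesis
      by (simp only: mult_ac)
  qed
qed

end
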